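(* Let $(T,\omega)$ and $(T',\omega')$ be strictly weighted stars such that $D_{(T,\mathsf m_\omega)}(\mathbf z)=D_{(T',\mathsf m_{\omega'})}(\mathbf z)$. Then $(T,\omega)$ and $(T',\omega')$ are $\omega$-isomorphic. (That is, a strictly weighted star can be reconstructed from its $D$-polynomial.)
   Context: A weighted tree $(T,\omega)$ has $\omega:V(T)\to\{1,2,\dots\}$; it is strictly weighted if all weights exceed $1$; it is a weighted star if $T$ is a star. $\omega$-isomorphic means isomorphic via a weight-preserving graph isomorphism. The marked version gives vertex $v$ the mark $(\omega(v),0)$; marks are pairs $(w,d)$ with $w\ge1,d\ge0,w\ge d+1$ and dot-sum $(w,d)\dotplus(w',d')=(w+w',d+d'+1)$. For a marked tree, $M_{(T,\mathsf m)}(\mathbf z)=\sum_{A\subseteq E(T)}\prod_C z_{\mathsf m(C)}$ over the connected components $C$ of $(V(T),A)$, with $\mathsf m(C)$ the dot-sum of the marks of the vertices of $C$ and $z_{w,d}$ commuting indeterminates. With $D_{\bullet_{w,d}}=\sum_{i=0}^d(-1)^i\binom di z_{w-i,0}z_{1,0}^i$, $D_{(T,\mathsf m)}(\mathbf z)$ is $M_{(T,\mathsf m)}$ with each $z_{w,d}$ replaced by $D_{\bullet_{w,d}}$. *)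

theory Defs
  imports Main "HOL-Library.Poly_Mapping"
begin

section \<open>Trees and stars\<close>

text \<open>A graph is given by its vertex set \<open>V\<close> and its set \<open>E\<close> of edges, which are
  two-element subsets of \<open>V\<close>.\<close>

definition simple_graph :: "'a set \<Rightarrow> 'a set set \<Rightarrow> bool" where
  "simple_graph V E \<longleftrightarrow> finite V \<and> (\<forall>e\<in>E. e \<subseteq> V \<and> card e = 2)"

definition reach :: "'a set \<Rightarrow> 'a set set \<Rightarrow> ('a \<times> 'a) set" where
  "reach V A = {(u, v). u \<in> V \<and> v \<in> V \<and> {u, v} \<in> A}\<^sup>* \<inter> V \<times> V"

definition components :: "'a set \<Rightarrow> 'a set set \<Rightarrow> 'a set set" where
  "components V A = V // reach V A"

definition connected_graph :: "'a set \<Rightarrow> 'a set set \<Rightarrow> bool" where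
  "connected_graph V E \<longleftrightarrow> V \<noteq> {} \<and> (\<forall>u\<in>V. \<forall>v\<in>V. (u, v) \<in> reach V E)"

definition is_cycle :: "'a set set \<Rightarrow> 'a list \<Rightarrow> bool" where
  "is_cycle E p \<longleftrightarrow> length p \<ge> 3 \<and> distinct p \<and>
     (\<forall>i. Suc i < length p \<longrightarrow> {p ! i, p ! Suc i} \<in> E) \<and> {last p, hd p} \<in> E"

definition is_tree :: "'a set \<Rightarrow> 'a set set \<Rightarrow> bool" where
  "is_tree V E \<longleftrightarrow> simple_graph V E \<and> connected_graph V E \<and> (\<nexists>p. is_cycle E p)"

text \<open>The complete bipartite graphs \<open>K\<^sub>1\<^sub>,\<^sub>n\<close> with \<open>n \<ge> 0\<close>; the one-vertex tree counts as a star.\<close>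

definition is_star :: "'a set \<Rightarrow> 'a set set \<Rightarrow> bool" where
  "is_star V E \<longleftrightarrow> (\<exists>c\<in>V. E = {{c, v} |v. v \<in> V - {c}})"

definition weighted_tree :: "'a set \<Rightarrow> 'a set set \<Rightarrow> ('a \<Rightarrow> nat) \<Rightarrow> bool" where
  "weighted_tree V E \<omega> \<longleftrightarrow> is_tree V E \<and> (\<forall>v\<in>V. \<omega> v \<ge> 1)"

definition strictly_weighted :: "'a set \<Rightarrow> ('a \<Rightarrow> nat) \<Rightarrow> bool" where
  "strictly_weighted V \<omega> \<longleftrightarrow> (\<forall>v\<in>V. \<omega> v > 1)"

definition weighted_star :: "'a set \<Rightarrow> 'a set set \<Rightarrow> ('a \<Rightarrow> nat) \<Rightarrow> bool" where
  "weighted_star V E \<omega> \<longleftrightarrow> weighted_tree V E \<omega> \<and> is_star V E"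

definition weight_isomorphic ::
  "'a set \<Rightarrow> 'a set set \<Rightarrow> ('a \<Rightarrow> nat) \<Rightarrow> 'b set \<Rightarrow> 'b set set \<Rightarrow> ('b \<Rightarrow> nat) \<Rightarrow> bool" where
  "weight_isomorphic V E \<omega> V' E' \<omega>' \<longleftrightarrow>
     (\<exists>f. bij_betw f V V' \<and>
          (\<forall>u\<in>V. \<forall>v\<in>V. {u, v} \<in> E \<longleftrightarrow> {f u, f v} \<in> E') \<and>
          (\<forall>v\<in>V. \<omega>' (f v) = \<omega> v))"


section \<open>Marks\<close>

type_synonym mark = "nat \<times> nat"

definition valid_mark :: "mark \<Rightarrow> bool" where
  "valid_mark m \<longleftrightarrow> fst m \<ge> 1 \<and> fst m \<ge> snd m + 1"

definition dot_add :: "mark \<Rightarrow> mark \<Rightarrow> mark" where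
  "dot_add m m' = (fst m + fst m', snd m + snd m' + 1)"

text \<open>The dot-sum of the marks of a nonempty finite set of vertices, in closed form; the lemmas
  \<open>dot_sum_singleton\<close> and \<open>dot_sum_insert\<close> show that it is the iterated \<open>dot_add\<close>.\<close>

definition dot_sum :: "('a \<Rightarrow> mark) \<Rightarrow> 'a set \<Rightarrow> mark" where
  "dot_sum m C = (\<Sum>v\<in>C. fst (m v), (\<Sum>v\<in>C. snd (m v)) + (card C - 1))"

lemma dot_sum_singleton: "dot_sum m {v} = m v"
  by (simp add: dot_sum_def)

lemma dot_sum_insert:
  assumes "finite C" "C \<noteq> {}" "v \<notin> C"
  shows "dot_sum m (insert v C) = dot_add (m v) (dot_sum m C)"
proof -
  have "card C \<ge> 1"
    using assms by (simp add: Suc_leI card_gt_0_iff)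
  then show ?thesis
    using assms by (simp add: dot_sum_def dot_add_def)
qed

definition mark_of_weight :: "('a \<Rightarrow> nat) \<Rightarrow> 'a \<Rightarrow> mark" where
  "mark_of_weight \<omega> v = (\<omega> v, 0)"

lemma valid_mark_dot_add: "valid_mark m \<Longrightarrow> valid_mark m' \<Longrightarrow> valid_mark (dot_add m m')"
  by (auto simp: valid_mark_def dot_add_def)

lemma valid_mark_of_weight: "weighted_tree V E \<omega> \<Longrightarrow> v \<in> V \<Longrightarrow> valid_mark (mark_of_weight \<omega> v)"
  by (simp add: weighted_tree_def valid_mark_def mark_of_weight_def)


section \<open>Polynomials in the indeterminates \<open>z\<^sub>w\<^sub>,\<^sub>d\<close>\<close>

text \<open>Monomials are finitely supported exponent functions, polynomials finitely supported
  coefficient functions on monomials, with the convolution product of \<open>Poly_Mapping\<close>.\<close>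

type_synonym zpoly = "(mark \<Rightarrow>\<^sub>0 nat) \<Rightarrow>\<^sub>0 int"

definition Z :: "mark \<Rightarrow> zpoly" where
  "Z m = Poly_Mapping.single (Poly_Mapping.single m 1) 1"

definition zsubst :: "(mark \<Rightarrow> zpoly) \<Rightarrow> zpoly \<Rightarrow> zpoly" where
  "zsubst f p = (\<Sum>t\<in>Poly_Mapping.keys p. of_int (Poly_Mapping.lookup p t) *
                   (\<Prod>m\<in>Poly_Mapping.keys t. f m ^ Poly_Mapping.lookup t m))"

lemma zsubst_Z: "zsubst f (Z m) = f m"
  by (simp add: zsubst_def Z_def)

definition M_poly :: "'a set \<Rightarrow> 'a set set \<Rightarrow> ('a \<Rightarrow> mark) \<Rightarrow> zpoly" where
  "M_poly V E m = (\<Sum>A\<in>Pow E. \<Prod>C\<in>components V A. Z (dot_sum m C))"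

text \<open>For a valid mark \<open>(w, d)\<close> the subtraction \<open>w - i\<close> is exact and positive, as \<open>i \<le> d < w\<close>.\<close>

definition D_dot :: "mark \<Rightarrow> zpoly" where
  "D_dot m = (\<Sum>i = 0..snd m.
     (-1) ^ i * of_nat (snd m choose i) * Z (fst m - i, 0) * Z (1, 0) ^ i)"

definition D_poly :: "'a set \<Rightarrow> 'a set set \<Rightarrow> ('a \<Rightarrow> mark) \<Rightarrow> zpoly" where
  "D_poly V E m = zsubst D_dot (M_poly V E m)"

end

theory Submission
  imports Defs "HOL-Library.Multiset"
begin

text \<open>
  Setting \<open>z\<^sub>1\<^sub>,\<^sub>0 = 0\<close> reduces \<open>D_dot (w, d)\<close> to its term \<open>z\<^sub>w\<^sub>,\<^sub>0\<close>, which survives because no component of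
  a strictly weighted tree has weight 1. What remains is a sum over \<open>A \<subseteq> E\<close> of monomials that record the
  multiset of component weights of \<open>(V, A)\<close>. For a star with centre weight \<open>a\<close> the largest of these
  multisets is the multiset \<open>\<Omega>\<close> of all vertex weights, and the ones with one element less arise from
  \<open>\<Omega>\<close> by merging \<open>a\<close> with a leaf weight \<open>b\<close> into \<open>a + b\<close>. As \<open>a + b\<close> exceeds \<open>a\<close> and \<open>b\<close>, the merged
  pair can be read off. If another star with centre weight \<open>a' \<noteq> a\<close> gives the same multisets, every
  such pair contains both \<open>a\<close> and \<open>a'\<close>; then \<open>\<Omega> = {a, a'}\<close>, and both stars are a single edge.
\<close>

section \<open>Substitution is a ring homomorphism\<close>

definition zmono :: "(mark \<Rightarrow> zpoly) \<Rightarrow> (mark \<Rightarrow>\<^sub>0 nat) \<Rightarrow> zpoly" where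
  "zmono f t = (\<Prod>m\<in>Poly_Mapping.keys t. f m ^ Poly_Mapping.lookup t m)"

text \<open>Indices outside the support contribute \<open>f m ^ 0 = 1\<close>. This lets several
  monomials be written over one common index set, which makes products comparable factor by
  factor.\<close>

lemma zmono_superset:
  assumes "finite K" "Poly_Mapping.keys t \<subseteq> K"
  shows "zmono f t = (\<Prod>m\<in>K. f m ^ Poly_Mapping.lookup t m)"
  unfolding zmono_def
  by (rule prod.mono_neutral_left) (use assms in \<open>auto simp: in_keys_iff\<close>)

lemma zmono_add: "zmono f (s + t) = zmono f s * zmono f t"
proof -
  let ?K = "Poly_Mapping.keys s \<union> Poly_Mapping.keys t"
  have "zmono f (s + t) = (\<Prod>m\<in>?K. f m ^ Poly_Mapping.lookup (s + t) m)"
    by (rule zmono_superset) (simp_all add: Poly_Mapping.keys_add)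
  also have "\<dots> = (\<Prod>m\<in>?K. f m ^ Poly_Mapping.lookup s m) * (\<Prod>m\<in>?K. f m ^ Poly_Mapping.lookup t m)"
    by (simp add: lookup_add power_add prod.distrib)
  also have "\<dots> = zmono f s * zmono f t"
    by (simp add: zmono_superset[of ?K])
  finally show ?thesis .
qed

lemma zsubst_superset:
  assumes "finite K" "Poly_Mapping.keys p \<subseteq> K"
  shows "zsubst f p = (\<Sum>t\<in>K. of_int (Poly_Mapping.lookup p t) * zmono f t)"
  unfolding zsubst_def zmono_def
  by (rule sum.mono_neutral_left) (use assms in \<open>auto simp: in_keys_iff\<close>)

lemma zsubst_zero: "zsubst f 0 = 0"
  by (simp add: zsubst_def)

lemma zsubst_one: "zsubst f 1 = 1"
  by (simp add: zsubst_def)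

lemma zsubst_add: "zsubst f (p + q) = zsubst f p + zsubst f q"
proof -
  let ?K = "Poly_Mapping.keys p \<union> Poly_Mapping.keys q"
  have "zsubst f (p + q) = (\<Sum>t\<in>?K. of_int (Poly_Mapping.lookup (p + q) t) * zmono f t)"
    by (rule zsubst_superset) (simp_all add: Poly_Mapping.keys_add)
  also have "\<dots> = (\<Sum>t\<in>?K. of_int (Poly_Mapping.lookup p t) * zmono f t) +
      (\<Sum>t\<in>?K. of_int (Poly_Mapping.lookup q t) * zmono f t)"
    by (simp add: lookup_add algebra_simps sum.distrib)
  also have "\<dots> = zsubst f p + zsubst f q"
    by (simp add: zsubst_superset[of ?K])
  finally show ?thesis .
qed

lemma zsubst_single: "zsubst f (Poly_Mapping.single t k) = of_int k * zmono f t"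
  by (simp add: zsubst_superset[of "{t}"])

lemma zsubst_sum: "zsubst f (sum p A) = (\<Sum>x\<in>A. zsubst f (p x))"
  by (induction A rule: infinite_finite_induct) (simp_all add: zsubst_zero zsubst_add)

lemma poly_mapping_eq_sum_single:
  "p = (\<Sum>t\<in>Poly_Mapping.keys p. Poly_Mapping.single t (Poly_Mapping.lookup p t))"
  by (rule poly_mapping_eqI) (simp add: lookup_sum lookup_single when_def in_keys_iff)

text \<open>Both factors are expanded into single terms; additivity then reduces the claim to
  products of monomials, where \<open>zmono_add\<close> applies.\<close>

lemma zsubst_mult: "zsubst f (p * q) = zsubst f p * zsubst f q"
proof -
  let ?s = "\<lambda>p t. Poly_Mapping.single t (Poly_Mapping.lookup p t)"
  have "p * q = (\<Sum>s\<in>Poly_Mapping.keys p. ?s p s) * (\<Sum>t\<in>Poly_Mapping.keys q. ?s q t)"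
    using poly_mapping_eq_sum_single[of p] poly_mapping_eq_sum_single[of q] by simp
  also have "zsubst f \<dots> =
      (\<Sum>s\<in>Poly_Mapping.keys p. zsubst f (?s p s)) * (\<Sum>t\<in>Poly_Mapping.keys q. zsubst f (?s q t))"
    by (simp add: sum_product zsubst_sum mult_single zsubst_single zmono_add mult_ac)
  also have "\<dots> = zsubst f p * zsubst f q"
    using poly_mapping_eq_sum_single[of p] poly_mapping_eq_sum_single[of q]
    by (simp flip: zsubst_sum)
  finally show ?thesis .
qed

lemma zsubst_prod: "zsubst f (prod p A) = (\<Prod>x\<in>A. zsubst f (p x))"
  by (induction A rule: infinite_finite_induct) (simp_all add: zsubst_one zsubst_mult)

lemma zsubst_power: "zsubst f (p ^ n) = zsubst f p ^ n"
  by (induction n) (simp_all add: zsubst_one zsubst_mult)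

section \<open>Component weights extracted from the D-polynomial\<close>

definition zkill :: "mark \<Rightarrow> zpoly" where
  "zkill m = (if m = (1, 0) then 0 else Z m)"

text \<open>Every term with \<open>i > 0\<close> carries the factor \<open>Z (1, 0) ^ i\<close>,
  which becomes \<open>0 ^ i = 0\<close>. The assumption protects the term \<open>i = 0\<close> from
  being killed as well.\<close>

lemma zsubst_zkill_D_dot:
  assumes "fst m \<noteq> 1"
  shows "zsubst zkill (D_dot m) = Z (fst m, 0)"
proof -
  have "zsubst zkill (D_dot m) = (\<Sum>i = 0..snd m. if i = 0 then Z (fst m, 0) else 0)"
    unfolding D_dot_def zsubst_sum
    by (rule sum.cong)
      (use assms in \<open>auto simp: zsubst_mult zsubst_power zsubst_Z zkill_def zsubst_one power_0_left\<close>)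
  then show ?thesis
    by simp
qed

definition component_weights :: "'a set \<Rightarrow> ('a \<Rightarrow> nat) \<Rightarrow> 'a set set \<Rightarrow> nat multiset" where
  "component_weights V \<omega> A = image_mset (sum \<omega>) (mset_set (components V A))"

definition weight_monomial :: "nat multiset \<Rightarrow> (mark \<Rightarrow>\<^sub>0 nat)" where
  "weight_monomial M = (\<Sum>w\<in>#M. Poly_Mapping.single (w, 0) 1)"

lemma lookup_weight_monomial: "Poly_Mapping.lookup (weight_monomial M) (w, 0) = count M w"
  by (induction M) (auto simp: weight_monomial_def lookup_add lookup_single)

text \<open>The exponent of the indeterminate with index \<open>(w, 0)\<close> is the multiplicity
  of \<open>w\<close>, so distinct multisets give distinct monomials.\<close>

lemma inj_weight_monomial: "inj weight_monomial"
  by (metis injI lookup_weight_monomial multiset_eqI)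

lemma prod_Z_weights:
  assumes "finite K"
  shows "(\<Prod>x\<in>K. Z (w x, 0)) = Poly_Mapping.single (weight_monomial (image_mset w (mset_set K))) 1"
  using assms
  by (induction K) (simp_all add: weight_monomial_def Z_def mult_single)

lemma component_subset: "C \<in> components V A \<Longrightarrow> C \<subseteq> V"
  by (auto simp: components_def quotient_def reach_def)

lemma component_nonempty: "C \<in> components V A \<Longrightarrow> C \<noteq> {}"
  by (auto simp: components_def quotient_def reach_def)

lemma finite_components: "finite V \<Longrightarrow> finite (components V A)"
  by (metis component_subset Pow_iff finite_Pow_iff finite_subset subsetI)

lemma zsubst_zkill_D_poly:
  assumes "finite V" "strictly_weighted V \<omega>"
  shows "zsubst zkill (D_poly V E (mark_of_weight \<omega>)) =
    (\<Sum>A\<in>Pow E. Poly_Mapping.single (weight_monomial (component_weights V \<omega> A)) 1)"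
proof -
  \<comment> \<open>A component contains some vertex, and that vertex alone has weight above 1;
    hence its total weight is not 1 and its factor survives.\<close>
  have *: "zsubst zkill (D_dot (dot_sum (mark_of_weight \<omega>) C)) = Z (sum \<omega> C, 0)"
    if C: "C \<in> components V A" for A C
  proof -
    obtain v where v: "v \<in> C"
      using component_nonempty[OF C] by auto
    have "finite C"
      using component_subset[OF C] assms(1) finite_subset by blast
    then have "\<omega> v \<le> sum \<omega> C"
      using v by (simp add: member_le_sum)
    moreover have "\<omega> v > 1"
      using assms(2) v component_subset[OF C] by (auto simp: strictly_weighted_def)
    ultimately have "sum \<omega> C \<noteq> 1"
      by linarith
    then show ?thesis
      using zsubst_zkill_D_dot[of "dot_sum (mark_of_weight \<omega>) C"]
      by (simp add: dot_sum_def mark_of_weight_def)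
  qed
  have "zsubst zkill (D_poly V E (mark_of_weight \<omega>)) =
      (\<Sum>A\<in>Pow E. \<Prod>C\<in>components V A. Z (sum \<omega> C, 0))"
    by (simp add: D_poly_def M_poly_def zsubst_sum zsubst_prod zsubst_Z *)
  then show ?thesis
    by (simp add: prod_Z_weights finite_components assms(1) component_weights_def)
qed

text \<open>All terms have coefficient 1, so nothing cancels and a monomial occurs exactly when some
  edge subset produces its multiset. Only the set of multisets is retained, not how often each one
  arises.\<close>

lemma component_weights_image_eq:
  assumes "finite V" "finite E" "strictly_weighted V \<omega>"
    and "finite V'" "finite E'" "strictly_weighted V' \<omega>'"
    and "D_poly V E (mark_of_weight \<omega>) = D_poly V' E' (mark_of_weight \<omega>')"
  shows "component_weights V \<omega> ` Pow E = component_weights V' \<omega>' ` Pow E'"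
proof -
  have supp: "Poly_Mapping.lookup (\<Sum>A\<in>F. Poly_Mapping.single (weight_monomial (g A)) (1::int))
      (weight_monomial M) \<noteq> 0 \<longleftrightarrow> M \<in> g ` F"
    if "finite F" for F :: "'c set" and g M
    using that
    by (auto simp: lookup_sum lookup_single when_def inj_eq[OF inj_weight_monomial]
        sum_nonneg_eq_0_iff)
  have "(\<Sum>A\<in>Pow E. Poly_Mapping.single (weight_monomial (component_weights V \<omega> A)) (1::int)) =
      (\<Sum>A\<in>Pow E'. Poly_Mapping.single (weight_monomial (component_weights V' \<omega>' A)) 1)"
    using assms zsubst_zkill_D_poly[of V \<omega> E] zsubst_zkill_D_poly[of V' \<omega>' E'] by simp
  then have "M \<in> component_weights V \<omega> ` Pow E \<longleftrightarrow> M \<in> component_weights V' \<omega>' ` Pow E'" for M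
    using supp[of "Pow E" "component_weights V \<omega>" M]
      supp[of "Pow E'" "component_weights V' \<omega>'" M] assms(2,5) by simp
  then show ?thesis
    by blast
qed

section \<open>Components of edge subsets of a star\<close>

definition star_edges :: "'a \<Rightarrow> 'a set \<Rightarrow> 'a set set" where
  "star_edges c S = {{c, v} |v. v \<in> S}"

lemma star_edges_eq_image: "star_edges c S = (\<lambda>v. {c, v}) ` S"
  by (auto simp: star_edges_def)

text \<open>Edge subsets of a star are thereby indexed by the sets of leaves that stay attached to
  the centre.\<close>

lemma Pow_star_edges: "Pow (star_edges c L) = star_edges c ` Pow L"
  unfolding star_edges_eq_image by (auto simp: subset_image_iff)

lemma components_star:
  assumes "c \<in> V" "S \<subseteq> V - {c}"
  shows "components V (star_edges c S) = insert (insert c S) ((\<lambda>v. {v}) ` (V - insert c S))"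
proof -
  let ?r = "{(u, v). u \<in> V \<and> v \<in> V \<and> {u, v} \<in> star_edges c S}"
  \<comment> \<open>The expected reachability relation: one block formed by the centre and its
    attached leaves, and isolated vertices otherwise.\<close>
  let ?R = "insert c S \<times> insert c S \<union> Id_on V"
  have "(u, v) \<in> ?R" if "(u, v) \<in> ?r\<^sup>*" "u \<in> V" for u v
    using that
    by (induction rule: rtrancl_induct) (auto simp: star_edges_def doubleton_eq_iff)
  moreover have "(u, v) \<in> ?r\<^sup>*" if uv: "(u, v) \<in> ?R" for u v
  proof -
    \<comment> \<open>Any two vertices of the block are joined by a walk through the centre.\<close>
    have centre: "(x, c) \<in> ?r\<^sup>* \<and> (c, x) \<in> ?r\<^sup>*" if "x \<in> insert c S" for x
    proof (cases "x = c")
      case False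
      then have "(x, c) \<in> ?r" "(c, x) \<in> ?r"
        using that assms by (auto simp: star_edges_def)
      then show ?thesis
        by blast
    qed simp
    consider "u = v" | "u \<in> insert c S" "v \<in> insert c S"
      using uv by blast
    then show ?thesis
    proof cases
      case 2
      then show ?thesis
        using rtrancl_trans[of u c ?r v] centre[of u] centre[of v] by simp
    qed simp
  qed
  moreover have "?R \<subseteq> V \<times> V"
    using assms by auto
  ultimately have R: "reach V (star_edges c S) = ?R"
    unfolding reach_def by blast
  have cl: "?R `` {x} = (if x \<in> insert c S then insert c S else {x})" if "x \<in> V" for x
    using that by auto
  have "V // ?R = (\<lambda>x. if x \<in> insert c S then insert c S else {x}) ` V"
    unfolding quotient_def UNION_singleton_eq_range using cl by (rule image_cong[OF refl])
  also have "\<dots> = insert (insert c S) ((\<lambda>v. {v}) ` (V - insert c S))"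
    using assms by auto
  finally show ?thesis
    by (simp add: components_def R)
qed

lemma component_weights_star:
  assumes "finite V" "c \<in> V" "S \<subseteq> V - {c}"
  shows "component_weights V \<omega> (star_edges c S) =
    add_mset (\<omega> c + sum \<omega> S) (image_mset \<omega> (mset_set (V - insert c S)))"
proof -
  have fin: "finite S"
    using assms finite_subset by blast
  \<comment> \<open>The central block is none of the isolated singletons, so it contributes its own
    element to the multiset.\<close>
  have "insert c S \<notin> (\<lambda>v. {v}) ` (V - insert c S)"
    by auto
  moreover have "mset_set ((\<lambda>v. {v}) ` (V - insert c S)) =
      image_mset (\<lambda>v. {v}) (mset_set (V - insert c S))"
    by (rule image_mset_mset_set[symmetric]) simp
  ultimately show ?thesis
    using assms fin
    by (simp add: component_weights_def components_star image_mset.compositionality comp_def subset_Diff_insert)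
qed

section \<open>Isomorphism of stars from centre weight and weight multiset\<close>

text \<open>Greedy matching: each new \<open>a\<close> is sent to any \<open>b\<close> of equal
  value, and the rest of the two multisets still agree.\<close>

lemma weight_preserving_bij:
  assumes "finite A" "finite B" "image_mset f (mset_set A) = image_mset g (mset_set B)"
  obtains h where "bij_betw h A B" "\<forall>x\<in>A. g (h x) = f x"
proof -
  have "\<exists>h. bij_betw h A B \<and> (\<forall>x\<in>A. g (h x) = f x)"
    using assms
  proof (induction A arbitrary: B)
    case empty
    then show ?case
      by (auto simp: mset_set_empty_iff bij_betw_def)
  next
    case (insert a A)
    then have "f a \<in># image_mset g (mset_set B)"
      by (metis add_mset_remove_trivial image_mset_add_mset mset_set.insert union_single_eq_member)
    then obtain b where b: "b \<in> B" "g b = f a"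
      using insert.prems by auto
    then have "mset_set B = add_mset b (mset_set (B - {b}))"
      using insert.prems by (simp add: mset_set.remove)
    then have "image_mset f (mset_set A) = image_mset g (mset_set (B - {b}))"
      using insert b by simp
    then obtain h where h: "bij_betw h A (B - {b})" "\<forall>x\<in>A. g (h x) = f x"
      using insert.IH[of "B - {b}"] insert.prems by auto
    have "bij_betw (h(a := b)) (insert a A) (insert b (B - {b}))"
      using h(1) insert.hyps
      by (auto simp: bij_betw_def inj_on_def)
    then have "bij_betw (h(a := b)) (insert a A) B"
      using b by (simp add: insert_absorb)
    moreover have "\<forall>x\<in>insert a A. g ((h(a := b)) x) = f x"
      using h b insert.hyps by auto
    ultimately show ?case
      by blast
  qed
  then show thesis
    using that by blast
qed

text \<open>Cancelling the equal centre weights leaves equal multisets of leaf weights. Any matching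
  of leaves extends to an isomorphism, since adjacency in a star depends only on which vertex is the
  centre.\<close>

lemma star_isomorphic:
  assumes "finite V" "finite V'" "c \<in> V" "c' \<in> V'"
    and "\<omega> c = \<omega>' c'"
    and "image_mset \<omega> (mset_set V) = image_mset \<omega>' (mset_set V')"
  shows "weight_isomorphic V (star_edges c (V - {c})) \<omega> V' (star_edges c' (V' - {c'})) \<omega>'"
proof -
  have "image_mset \<omega> (mset_set (V - {c})) = image_mset \<omega>' (mset_set (V' - {c'}))"
    using assms by (simp add: mset_set.remove)
  then obtain h where h: "bij_betw h (V - {c}) (V' - {c'})" "\<forall>x\<in>V - {c}. \<omega>' (h x) = \<omega> x"
    using weight_preserving_bij[of "V - {c}" "V' - {c'}" \<omega> \<omega>'] assms by auto
  let ?f = "h(c := c')"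
  have "bij_betw ?f (insert c (V - {c})) (insert c' (V' - {c'}))"
    using h(1) by (auto simp: bij_betw_def inj_on_def)
  then have f: "bij_betw ?f V V'"
    using assms by (simp add: insert_absorb)
  have adj: "{u, v} \<in> star_edges x (W - {x}) \<longleftrightarrow> u \<noteq> v \<and> (u = x \<or> v = x)"
    if "u \<in> W" "v \<in> W" for u v x and W :: "'c set"
    using that by (auto simp: star_edges_def doubleton_eq_iff)
  have fc: "?f u = c' \<longleftrightarrow> u = c" if "u \<in> V" for u
    using inj_on_eq_iff[OF bij_betw_imp_inj_on[OF f] that assms(3)] by simp
  have "{u, v} \<in> star_edges c (V - {c}) \<longleftrightarrow> {?f u, ?f v} \<in> star_edges c' (V' - {c'})"
    if "u \<in> V" "v \<in> V" for u v
  proof -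
    have "?f u \<in> V'" "?f v \<in> V'" "?f u = ?f v \<longleftrightarrow> u = v"
      using f that by (auto simp: bij_betw_def inj_on_eq_iff simp del: fun_upd_apply)
    then show ?thesis
      using adj[of u V v c] adj[of "?f u" V' "?f v" c'] fc that by simp
  qed
  moreover have "\<forall>v\<in>V. \<omega>' (?f v) = \<omega> v"
    using h(2) assms by auto
  ultimately show ?thesis
    unfolding weight_isomorphic_def using f by blast
qed

section \<open>Comparing the multisets of two stars\<close>

lemma star_component_weights_image:
  assumes "finite V" "c \<in> V"
  shows "component_weights V \<omega> ` Pow (star_edges c (V - {c})) =
    {add_mset (\<omega> c + sum \<omega> S) (image_mset \<omega> (mset_set (V - insert c S))) |S. S \<subseteq> V - {c}}"
  unfolding Pow_star_edges image_image setcompr_eq_image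
  using assms by (intro image_cong) (auto simp: component_weights_star)

text \<open>Each attached leaf lowers the number of components by one, so the size of a multiset
  determines \<open>card S\<close>.\<close>

lemma size_star_monomial:
  assumes "finite V" "c \<in> V" "S \<subseteq> V - {c}"
  shows "size (add_mset k (image_mset \<omega> (mset_set (V - insert c S)))) + card S = card V"
proof -
  have S: "finite S" "c \<notin> S" "insert c S \<subseteq> V"
    using assms finite_subset by auto
  then have "card (V - insert c S) + card (insert c S) = card V"
    using card_Diff_subset[of "insert c S" V] card_mono[of V "insert c S"] assms by simp
  then show ?thesis
    using S by simp
qed

text \<open>Eliminates the unknown remainders \<open>x\<close> and \<open>x'\<close> by adding the
  equations crosswise, avoiding multiset subtraction.\<close>

lemma cross_cancel_mset:
  fixes p q x p' q' x' :: "'a multiset"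
  assumes "p + x = p' + x'" "q + x = q' + x'"
  shows "q + p' = q' + p"
proof -
  have "(q + p') + (x + x') = (q + x) + (p' + x')"
    by (simp only: add_ac)
  also have "\<dots> = (q' + x') + (p + x)"
    using assms by simp
  also have "\<dots> = (q' + p) + (x + x')"
    by (simp only: add_ac)
  finally show ?thesis
    by (rule add_right_imp_eq)
qed

context
  fixes V :: "'a set" and c :: 'a and \<omega> :: "'a \<Rightarrow> nat"
    and V' :: "'b set" and c' :: 'b and \<omega>' :: "'b \<Rightarrow> nat"
  assumes fin: "finite V" "finite V'"
    and c: "c \<in> V" "c' \<in> V'"
    and weights: "component_weights V \<omega> ` Pow (star_edges c (V - {c})) =
        component_weights V' \<omega>' ` Pow (star_edges c' (V' - {c'}))"
begin

lemma star_weights_match: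
  assumes "S \<subseteq> V - {c}"
  obtains S' where "S' \<subseteq> V' - {c'}"
    "add_mset (\<omega> c + sum \<omega> S) (image_mset \<omega> (mset_set (V - insert c S))) =
      add_mset (\<omega>' c' + sum \<omega>' S') (image_mset \<omega>' (mset_set (V' - insert c' S')))"
    "card V + card S' = card V' + card S"
proof -
  have "add_mset (\<omega> c + sum \<omega> S) (image_mset \<omega> (mset_set (V - insert c S))) \<in>
      component_weights V' \<omega>' ` Pow (star_edges c' (V' - {c'}))"
    using assms weights star_component_weights_image[OF fin(1) c(1), of \<omega>] by blast
  then obtain S' where S': "S' \<subseteq> V' - {c'}"
    "add_mset (\<omega> c + sum \<omega> S) (image_mset \<omega> (mset_set (V - insert c S))) =
      add_mset (\<omega>' c' + sum \<omega>' S') (image_mset \<omega>' (mset_set (V' - insert c' S')))"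
    unfolding star_component_weights_image[OF fin(2) c(2)] by blast
  then show thesis
    using that size_star_monomial[OF fin(1) c(1) assms, of "\<omega> c + sum \<omega> S" \<omega>]
      size_star_monomial[OF fin(2) c(2) S'(1), of "\<omega>' c' + sum \<omega>' S'" \<omega>'] by simp
qed

text \<open>The edgeless subgraph has \<open>card V\<close> components, and some subgraph of the
  other star must have as many. Equality follows later by exchanging the two stars.\<close>

lemma star_card_le: "card V \<le> card V'"
  by (rule star_weights_match[of "{}"]) auto

lemma star_weights_eq:
  assumes "card V = card V'"
  shows "image_mset \<omega> (mset_set V) = image_mset \<omega>' (mset_set V')"
proof (rule star_weights_match[of "{}"])
  fix S'
  assume S': "S' \<subseteq> V' - {c'}" "card V + card S' = card V' + card {}"
    "add_mset (\<omega> c + sum \<omega> {}) (image_mset \<omega> (mset_set (V - insert c {}))) =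
      add_mset (\<omega>' c' + sum \<omega>' S') (image_mset \<omega>' (mset_set (V' - insert c' S')))"
  then have "S' = {}"
    using assms fin(2) finite_subset by fastforce
  then show ?thesis
    using S'(3) fin c by (simp add: mset_set.remove)
qed simp

text \<open>Merging \<open>v\<close> into its centre corresponds to merging some \<open>v'\<close>
  into the other centre. Comparing with the full weight multisets cancels all remaining leaves and
  leaves an identity between multisets of three weights.\<close>

lemma star_leaf_weight:
  assumes pos: "\<forall>v\<in>V'. \<omega>' v > 0"
    and cards: "card V = card V'"
    and neq: "\<omega> c \<noteq> \<omega>' c'" and v: "v \<in> V - {c}"
  shows "\<omega> v = \<omega>' c'"
proof (rule star_weights_match[of "{v}"])
  fix S'
  assume S': "S' \<subseteq> V' - {c'}" "card V + card S' = card V' + card {v}"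
    "add_mset (\<omega> c + sum \<omega> {v}) (image_mset \<omega> (mset_set (V - insert c {v}))) =
      add_mset (\<omega>' c' + sum \<omega>' S') (image_mset \<omega>' (mset_set (V' - insert c' S')))"
  \<comment> \<open>As the vertex counts agree, \<open>card S' = card {v} = 1\<close>.\<close>
  then obtain v' where v': "S' = {v'}"
    using cards by (auto simp: card_1_singleton_iff)
  let ?X = "image_mset \<omega> (mset_set (V - {c, v}))"
  let ?X' = "image_mset \<omega>' (mset_set (V' - {c', v'}))"
  have split: "mset_set W = {#x, y#} + mset_set (W - {x, y})"
    if "finite W" "x \<in> W" "y \<in> W - {x}" for W :: "'c set" and x y
    using that mset_set.remove[of W x] mset_set.remove[of "W - {x}" y]
    by (simp add: Diff_insert[symmetric] insert_commute)
  have "{#\<omega> c, \<omega> v#} + ?X = {#\<omega>' c', \<omega>' v'#} + ?X'"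
    using star_weights_eq[OF cards] split[OF fin(1) c(1) v] split[OF fin(2) c(2), of v'] S'(1) v'
    by simp
  moreover have "{#\<omega> c + \<omega> v#} + ?X = {#\<omega>' c' + \<omega>' v'#} + ?X'"
    using S'(3) v' by simp
  ultimately have "{#\<omega> c + \<omega> v#} + {#\<omega>' c', \<omega>' v'#} = {#\<omega>' c' + \<omega>' v'#} + {#\<omega> c, \<omega> v#}"
    by (rule cross_cancel_mset)
  \<comment> \<open>Membership is transported to the other side of the identity. There
    \<open>\<omega>' c'\<close> differs from \<open>\<omega>' c' + \<omega>' v'\<close> by
    positivity and from \<open>\<omega> c\<close> by assumption, so only \<open>\<omega> v\<close>
    remains.\<close>
  moreover have "\<omega>' c' \<in># {#\<omega> c + \<omega> v#} + {#\<omega>' c', \<omega>' v'#}"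
    by simp
  ultimately have "\<omega>' c' \<in># {#\<omega>' c' + \<omega>' v'#} + {#\<omega> c, \<omega> v#}"
    by (simp only:)
  moreover have "\<omega>' v' > 0"
    using pos S'(1) v' by auto
  ultimately show ?thesis
    using neq by auto
qed (use v in auto)

end

text \<open>If the centre weights differ, every leaf of either star carries the weight of the other
  centre. The common weight multiset then leaves room for just one leaf, and a single edge may be
  centred at either end.\<close>

lemma star_reconstruction:
  assumes fin: "finite V" "finite V'"
    and c: "c \<in> V" "c' \<in> V'"
    and pos: "\<forall>v\<in>V. \<omega> v > 0" "\<forall>v\<in>V'. \<omega>' v > 0"
    and weights: "component_weights V \<omega> ` Pow (star_edges c (V - {c})) =
        component_weights V' \<omega>' ` Pow (star_edges c' (V' - {c'}))"
  shows "weight_isomorphic V (star_edges c (V - {c})) \<omega> V' (star_edges c' (V' - {c'})) \<omega>'"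
proof -
  have cards: "card V = card V'"
    using star_card_le[OF fin c weights] star_card_le[OF fin(2,1) c(2,1) weights[symmetric]]
    by simp
  have \<Omega>: "image_mset \<omega> (mset_set V) = image_mset \<omega>' (mset_set V')"
    by (rule star_weights_eq[OF fin c weights cards])
  show ?thesis
  proof (cases "\<omega> c = \<omega>' c'")
    case True
    then show ?thesis
      using star_isomorphic[OF fin c _ \<Omega>] by simp
  next
    case False
    have leaf: "\<omega> v = \<omega>' c'" if "v \<in> V - {c}" for v
      using star_leaf_weight[OF fin c weights pos(2) cards False that] .
    have leaf': "\<omega>' v = \<omega> c" if "v \<in> V' - {c'}" for v
      using star_leaf_weight[OF fin(2,1) c(2,1) weights[symmetric] pos(1) cards[symmetric] _ that]
        False by simp
    have const: "image_mset f (mset_set (W - {x})) = replicate_mset (card (W - {x})) k"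
      if "finite W" "\<And>v. v \<in> W - {x} \<Longrightarrow> f v = k"
      for W :: "'c set" and x and k :: nat and f
    proof -
      have "image_mset f (mset_set (W - {x})) = image_mset (\<lambda>_. k) (mset_set (W - {x}))"
        using that by (intro image_mset_cong) auto
      then show ?thesis
        by (simp add: image_mset_const_eq)
    qed
    have "add_mset (\<omega> c) (replicate_mset (card (V - {c})) (\<omega>' c')) =
        add_mset (\<omega>' c') (replicate_mset (card (V' - {c'})) (\<omega> c))"
      using \<Omega> const[OF fin(1) leaf] const[OF fin(2) leaf'] fin c by (simp add: mset_set.remove)
    \<comment> \<open>The left count is 1 because the centre weights differ; the right count is the
      number of leaves in \<open>V'\<close>. This also rules out one-vertex stars.\<close>
    then have "count (add_mset (\<omega> c) (replicate_mset (card (V - {c})) (\<omega>' c'))) (\<omega> c) =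
        count (add_mset (\<omega>' c') (replicate_mset (card (V' - {c'})) (\<omega> c))) (\<omega> c)"
      by simp
    then have "card (V' - {c'}) = 1"
      using False by simp
    then obtain v' where v': "V' - {c'} = {v'}"
      by (auto simp: card_1_singleton_iff)
    then have V': "V' = {c', v'}" "v' \<noteq> c'"
      using c by auto
    then have "V' - {v'} = {c'}"
      by auto
    \<comment> \<open>The second star is recentred at its leaf \<open>v'\<close>, whose weight
      equals \<open>\<omega> c\<close>, so the equal-centre case applies.\<close>
    then have "star_edges v' (V' - {v'}) = star_edges c' (V' - {c'})"
      by (simp add: v' star_edges_def insert_commute)
    moreover have "\<omega> c = \<omega>' v'"
      using leaf' v' by simp
    ultimately show ?thesis
      using star_isomorphic[OF fin c(1), of v' \<omega> \<omega>'] \<Omega> V' by simp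
  qed
qed

theorem theorem7p15:
  fixes V :: "'a set" and E :: "'a set set" and \<omega> :: "'a \<Rightarrow> nat"
    and V' :: "'b set" and E' :: "'b set set" and \<omega>' :: "'b \<Rightarrow> nat"
  assumes "weighted_star V E \<omega>" and "strictly_weighted V \<omega>"
    and "weighted_star V' E' \<omega>'" and "strictly_weighted V' \<omega>'"
    and "D_poly V E (mark_of_weight \<omega>) = D_poly V' E' (mark_of_weight \<omega>')"
  shows "weight_isomorphic V E \<omega> V' E' \<omega>'"
proof -
  obtain c c' where c: "c \<in> V" "c' \<in> V'"
    and E: "E = star_edges c (V - {c})" "E' = star_edges c' (V' - {c'})"
    using assms(1,3) unfolding weighted_star_def is_star_def star_edges_def by blast
  have fin: "finite V" "finite V'"
    using assms(1,3)
    by (simp_all add: weighted_star_def weighted_tree_def is_tree_def simple_graph_def)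
  have pos: "\<forall>v\<in>V. \<omega> v > 0" "\<forall>v\<in>V'. \<omega>' v > 0"
    using assms(2,4) by (auto simp: strictly_weighted_def)
  have "finite E" "finite E'"
    using fin by (simp_all add: E star_edges_eq_image)
  then have "component_weights V \<omega> ` Pow E = component_weights V' \<omega>' ` Pow E'"
    using component_weights_image_eq[OF fin(1) _ assms(2) fin(2) _ assms(4,5)] by simp
  then show ?thesis
    using star_reconstruction[OF fin c pos] E by simp
qed

end
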